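(* Let $G$ be a finite poset game with $g$ vertices and suppose $\mathrm{Nim}(G)=0$. Let $\neg G$ be the poset game produced from $G$ by the following procedure: 1. Set $i=0$ and let the current game be $G$. 2. While $2^i\le g$: add $2^i$ bottom vertices (one after another) to the current game, then put the result next to a $2^i$-tower; this is the new current game; then increment $i$ by $1$. 3. Let the resulting game be $G'$. 4. Take a copy of $G'$, add $2^i$ bottom vertices to it (one after another), and put the result next to a $2^i$-tower, obtaining $G''$. Then increment $i$ by $1$. 5. Put $G'$ next to $G''$ and next to a $2^i$-tower (with the current value of $i$), obtaining $\neg G$. Then $\mathrm{Nim}(\neg G)\neq 0$.
   Context: A poset game is played on a finite partially ordered set $(V,\le)$, whose elements are called vertices. Two players alternate moves; a move consists of choosing a remaining element $v$ and removing all remaining elements $w$ with $w\ge v$. A player who cannot move (because no elements remain) loses. The nim-value $\mathrm{Nim}(G)$ is defined recursively as the smallest non-negative integer $m$ such that no move from $G$ leads to a game of nim-value $m$ (so the empty game has nim-value $0$); the second player has a winning strategy on $G$ if and only if $\mathrm{Nim}(G)=0$. Adding a bottom vertex to a poset means adjoining one new element that is strictly less than all elements present at that time. An $x$-tower is a chain of $x$ elements. Putting games next to each other means taking the disjoint union of the posets, with elements from different components incomparable (disjoint copies are used when a game occurs more than once). *)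

theory Defs
  imports Main "HOL-Library.While_Combinator"
begin

text \<open>
  A poset is represented by its (reflexive) order relation \<open>r\<close>, where \<open>(v, w) \<in> r\<close> means
  \<open>v \<le> w\<close>; since the relation is reflexive, its set of vertices is \<open>Field r\<close>.
\<close>

definition poset_game :: "'a rel \<Rightarrow> bool" where
  "poset_game r \<longleftrightarrow> finite (Field r) \<and> partial_order_on (Field r) r"

definition move :: "'a rel \<Rightarrow> 'a \<Rightarrow> 'a rel" where
  "move r v = Restr r (Field r - {w. (v, w) \<in> r})"

lemma Field_move:
  assumes "poset_game r"
  shows "Field (move r v) = Field r - {w. (v, w) \<in> r}"
  using assms
  by (auto simp: poset_game_def move_def partial_order_on_def preorder_on_def refl_on_def Field_def)

lemma poset_game_move:
  assumes "poset_game r"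
  shows "poset_game (move r v)"
proof -
  have r: "finite (Field r)" "refl_on (Field r) r" "trans r" "antisym r"
    using assms by (simp_all add: poset_game_def partial_order_on_def preorder_on_def)
  have "refl_on (Field (move r v)) (move r v)"
    using r(2) unfolding Field_move[OF assms] by (auto simp: move_def refl_on_def)
  moreover have "move r v \<subseteq> Field (move r v) \<times> Field (move r v)"
    by (auto simp: Field_def)
  moreover have "trans (move r v)"
    using r(3) unfolding move_def trans_def by blast
  moreover have "antisym (move r v)"
    using r(4) unfolding move_def antisym_def by blast
  moreover have "finite (Field (move r v))"
    using r(1) by (simp add: Field_move[OF assms])
  ultimately show ?thesis
    by (simp add: poset_game_def partial_order_on_def preorder_on_def)
qed

text \<open>
  The value \<open>0\<close> outside \<open>poset_game\<close> is a dummy that makes the recursion terminate; by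
  \<open>poset_game_move\<close> it is never reached from a finite poset (see \<open>nim_eq\<close>).
\<close>

function nim :: "'a rel \<Rightarrow> nat" where
  "nim r = (if poset_game r then LEAST m. m \<notin> (\<lambda>v. nim (move r v)) ` Field r else 0)"
  by pat_completeness auto
termination
proof (relation "measure (\<lambda>r. card (Field r))")
  fix r :: "'a rel" and v
  assume r: "poset_game r" and v: "v \<in> Field r"
  then have "v \<notin> Field (move r v)"
    by (auto simp: Field_move poset_game_def partial_order_on_def preorder_on_def refl_on_def)
  with r v have "Field (move r v) \<subset> Field r"
    by (auto simp: Field_move)
  with r show "(move r v, r) \<in> measure (\<lambda>r. card (Field r))"
    by (simp add: poset_game_def psubset_card_mono)
qed simp

declare nim.simps [simp del]

lemma nim_eq:
  "poset_game r \<Longrightarrow> nim r = (LEAST m. m \<notin> (\<lambda>v. nim (move r v)) ` Field r)"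
  by (subst nim.simps) simp

text \<open>
  All posets built from one over \<open>'a\<close> live on the following type of vertices: \<open>Level i\<close> is
  the \<open>i\<close>-th vertex of a tower, \<open>Bottom\<close> is a freshly added bottom vertex, and \<open>Inl_Vertex\<close>,
  \<open>Inr_Vertex\<close> produce disjoint copies.
\<close>

datatype 'a vertex =
    Base 'a
  | Level nat
  | Bottom
  | Inl_Vertex "'a vertex"
  | Inr_Vertex "'a vertex"

definition embed :: "'a rel \<Rightarrow> 'a vertex rel" where
  "embed r = map_prod Base Base ` r"

definition tower :: "nat \<Rightarrow> 'a vertex rel" where
  "tower x = {(Level i, Level j) | i j. i \<le> j \<and> j < x}"

definition add_bottom :: "'a vertex rel \<Rightarrow> 'a vertex rel" where
  "add_bottom r =
     {Bottom} \<times> insert Bottom (Inl_Vertex ` Field r) \<union> map_prod Inl_Vertex Inl_Vertex ` r"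

definition next_to :: "'a vertex rel \<Rightarrow> 'a vertex rel \<Rightarrow> 'a vertex rel" where
  "next_to r s = map_prod Inl_Vertex Inl_Vertex ` r \<union> map_prod Inr_Vertex Inr_Vertex ` s"

definition extend :: "nat \<Rightarrow> 'a vertex rel \<Rightarrow> 'a vertex rel" where
  "extend i r = next_to ((add_bottom ^^ (2 ^ i)) r) (tower (2 ^ i))"

definition neg_game :: "'a rel \<Rightarrow> 'a vertex rel" where
  "neg_game G =
     (let g = card (Field G);
          (i, G') = while (\<lambda>(i, H). 2 ^ i \<le> g) (\<lambda>(i, H). (i + 1, extend i H)) (0, embed G);
          G'' = extend i G';
          i' = i + 1
      in next_to (next_to G' G'') (tower (2 ^ i')))"

end

(* Adding a bottom vertex raises the nim-value by one, an x-tower has nim-value x, and a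
   disjoint union has nim-value 0 iff its two components have equal nim-values. Hence each
   round of the procedure turns nim-value 0 into 2^i next to 2^i, which is 0 again, so
   both G' and G'' have nim-value 0. Next to a nonempty tower they give a nonzero
   nim-value. *)
theory Submission
  imports Defs
begin

section \<open>Nim-values as minimal excludants\<close>

text \<open>The option values form a finite set, so some natural number is missing and the
  \<open>LEAST\<close> in \<open>nim_eq\<close> is attained.\<close>

lemma nim_notin_image_move:
  assumes "poset_game r"
  shows "nim r \<notin> (\<lambda>v. nim (move r v)) ` Field r"
proof -
  have "finite ((\<lambda>v. nim (move r v)) ` Field r)"
    using assms by (simp add: poset_game_def)
  then have "\<exists>m. m \<notin> (\<lambda>v. nim (move r v)) ` Field r"
    by (rule ex_new_if_finite[OF infinite_UNIV_nat])
  then show ?thesis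
    unfolding nim_eq[OF assms] by (rule LeastI_ex)
qed

lemma nim_move_neq: "poset_game r \<Longrightarrow> v \<in> Field r \<Longrightarrow> nim (move r v) \<noteq> nim r"
  using nim_notin_image_move by (metis imageI)

lemma nim_optionE:
  assumes "poset_game r" "m < nim r"
  obtains v where "v \<in> Field r" "nim (move r v) = m"
  using assms not_less_Least unfolding nim_eq[OF assms(1)] by blast

lemma nim_eqI:
  assumes "poset_game r"
    and "\<And>v. v \<in> Field r \<Longrightarrow> nim (move r v) \<noteq> m"
    and "\<And>k. k < m \<Longrightarrow> \<exists>v\<in>Field r. nim (move r v) = k"
  shows "nim r = m"
  unfolding nim_eq[OF assms(1)]
proof (rule Least_equality)
  show "m \<notin> (\<lambda>v. nim (move r v)) ` Field r"
    using assms(2) by blast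
  show "m \<le> k" if "k \<notin> (\<lambda>v. nim (move r v)) ` Field r" for k
    using assms(3)[of k] that by (metis imageI not_le)
qed

text \<open>No value lies below 0, so avoiding 0 among the options is the whole condition on the
  minimal excludant.\<close>

lemma nim_eq_0_iff:
  assumes "poset_game r"
  shows "nim r = 0 \<longleftrightarrow> (\<forall>v\<in>Field r. nim (move r v) \<noteq> 0)"
  using assms nim_eqI[of r 0] nim_move_neq by fastforce

lemma poset_game_iff:
  "poset_game r \<longleftrightarrow> finite (Field r) \<and> (\<forall>x\<in>Field r. (x, x) \<in> r) \<and> trans r \<and> antisym r"
  unfolding poset_game_def partial_order_on_def preorder_on_def refl_on_def
  by (auto simp: Field_def)

lemma poset_game_empty: "poset_game {}"
  by (simp add: poset_game_iff)

lemma nim_empty: "nim {} = 0"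
  by (rule nim_eqI) (auto simp: poset_game_empty)

section \<open>Isomorphic copies\<close>

lemma Field_map_prod_image: "Field (map_prod f f ` r) = f ` Field r"
  by (force simp: Field_def)

lemma poset_game_map_prod:
  assumes "inj f" "poset_game r"
  shows "poset_game (map_prod f f ` r)"
proof -
  have "trans (map_prod f f ` r)"
    using assms by (auto simp: poset_game_iff trans_def dest!: injD[OF assms(1)])
  moreover have "antisym (map_prod f f ` r)"
    using assms by (auto simp: poset_game_iff antisym_def dest!: injD[OF assms(1)])
  ultimately show ?thesis
    using assms(2) by (auto simp: poset_game_iff Field_map_prod_image)
qed

lemma move_map_prod:
  assumes "inj f"
  shows "move (map_prod f f ` r) (f v) = map_prod f f ` move r v"
proof -
  have "(f v, f w) \<in> map_prod f f ` r \<longleftrightarrow> (v, w) \<in> r" for w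
    by (auto dest!: injD[OF assms])
  then show ?thesis
    unfolding move_def Field_map_prod_image by (force dest!: injD[OF assms])
qed

text \<open>Injective renaming commutes with moves, so by induction both games have the same option
  values. This carries \<open>nim G = 0\<close> over to the vertex type of the construction.\<close>

lemma nim_map_prod:
  assumes "inj f" "poset_game r"
  shows "nim (map_prod f f ` r) = nim r"
proof -
  have "poset_game r \<longrightarrow> nim (map_prod f f ` r) = nim r"
  proof (induction r rule: nim.induct)
    case (1 r)
    show ?case
    proof
      assume r: "poset_game r"
      then have "nim (move (map_prod f f ` r) (f v)) = nim (move r v)" if "v \<in> Field r" for v
        using 1 that by (simp add: move_map_prod[OF assms(1)] poset_game_move)
      then have "(\<lambda>v. nim (move (map_prod f f ` r) v)) ` Field (map_prod f f ` r)
          = (\<lambda>v. nim (move r v)) ` Field r"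
        by (force simp: Field_map_prod_image)
      then show "nim (map_prod f f ` r) = nim r"
        using r poset_game_map_prod[OF assms(1) r] by (simp add: nim_eq)
    qed
  qed
  with assms(2) show ?thesis by simp
qed

lemma poset_game_embed: "poset_game r \<Longrightarrow> poset_game (embed r)"
  unfolding embed_def by (intro poset_game_map_prod) (auto simp: inj_def)

lemma nim_embed: "poset_game r \<Longrightarrow> nim (embed r) = nim r"
  unfolding embed_def by (intro nim_map_prod) (auto simp: inj_def)

section \<open>Towers\<close>

lemma Field_tower: "Field (tower x) = Level ` {..<x}"
  by (auto simp: Field_def tower_def)

lemma poset_game_tower: "poset_game (tower x)"
  unfolding poset_game_iff Field_tower by (auto simp: tower_def trans_def antisym_def)

lemma move_tower: "i < x \<Longrightarrow> move (tower x) (Level i) = tower i"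
  unfolding move_def Field_tower by (auto simp: tower_def)

text \<open>Cutting at level \<open>i\<close> leaves the \<open>i\<close> levels below it, so the
  options have exactly the values below \<open>x\<close>.\<close>

lemma nim_tower: "nim (tower x) = x"
proof (induction x rule: less_induct)
  case (less x)
  show ?case
    by (rule nim_eqI) (auto simp: poset_game_tower Field_tower move_tower less)
qed

section \<open>Bottom vertices\<close>

lemma Field_add_bottom: "Field (add_bottom r) = insert Bottom (Inl_Vertex ` Field r)"
  by (force simp: Field_def add_bottom_def)

lemma poset_game_add_bottom:
  assumes "poset_game r"
  shows "poset_game (add_bottom r)"
proof -
  have "trans (add_bottom r)"
    \<comment> \<open>A chain starting at \<open>Bottom\<close> needs the upper end of a pair of
      \<open>r\<close> to lie in the field, hence \<open>Field_def\<close>.\<close>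
    using assms by (auto simp: poset_game_iff add_bottom_def trans_def Field_def; blast)
  moreover have "antisym (add_bottom r)"
    using assms by (auto simp: poset_game_iff add_bottom_def antisym_def)
  ultimately show ?thesis
    using assms unfolding poset_game_iff Field_add_bottom by (auto simp: add_bottom_def)
qed

lemma move_add_bottom_Bottom: "move (add_bottom r) Bottom = {}"
  unfolding move_def Field_add_bottom by (auto simp: add_bottom_def)

text \<open>\<open>Bottom\<close> lies above no other vertex, so it survives. The order hypothesis
  enters through \<open>Field_move\<close>: reflexive pairs keep each surviving vertex in the
  field.\<close>

lemma move_add_bottom_Inl:
  assumes "poset_game r"
  shows "move (add_bottom r) (Inl_Vertex v) = add_bottom (move r v)"
proof -
  have "(Inl_Vertex v, Inl_Vertex w) \<in> add_bottom r \<longleftrightarrow> (v, w) \<in> r"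
    "(Inl_Vertex v, Bottom) \<notin> add_bottom r" for w
    by (auto simp: add_bottom_def)
  then show ?thesis
    unfolding move_def[of "add_bottom r"] Field_add_bottom
    unfolding add_bottom_def Field_move[OF assms] by (auto simp: move_def)
qed

text \<open>Taking \<open>Bottom\<close> empties the game and gives value 0; by induction every
  other move gives an option value of \<open>r\<close> shifted up by one. The minimal excludant is
  therefore shifted by one as well.\<close>

lemma nim_add_bottom:
  assumes "poset_game r"
  shows "nim (add_bottom r) = Suc (nim r)"
proof -
  have "poset_game r \<longrightarrow> nim (add_bottom r) = Suc (nim r)"
  proof (induction r rule: nim.induct)
    case (1 r)
    show ?case
    proof
      assume r: "poset_game r"
      have move: "nim (move (add_bottom r) (Inl_Vertex v)) = Suc (nim (move r v))"
        if "v \<in> Field r" for v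
        using 1 r that by (simp add: move_add_bottom_Inl poset_game_move)
      show "nim (add_bottom r) = Suc (nim r)"
      proof (rule nim_eqI)
        show "poset_game (add_bottom r)"
          using r by (rule poset_game_add_bottom)
        show "nim (move (add_bottom r) v) \<noteq> Suc (nim r)" if "v \<in> Field (add_bottom r)" for v
          using that nim_move_neq[OF r]
          by (auto simp: Field_add_bottom move_add_bottom_Bottom nim_empty move)
        show "\<exists>v\<in>Field (add_bottom r). nim (move (add_bottom r) v) = k" if "k < Suc (nim r)" for k
        proof (cases k)
          case 0
          then show ?thesis
            by (simp add: Field_add_bottom move_add_bottom_Bottom nim_empty)
        next
          case (Suc m)
          with that obtain v where "v \<in> Field r" "nim (move r v) = m"
            using nim_optionE[OF r, of m] by auto
          with Suc show ?thesis
            by (auto simp: Field_add_bottom move)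
        qed
      qed
    qed
  qed
  with assms show ?thesis by simp
qed

lemma add_bottom_funpow:
  assumes "poset_game r"
  shows "poset_game ((add_bottom ^^ n) r)" "nim ((add_bottom ^^ n) r) = nim r + n"
  using assms by (induction n) (auto simp: poset_game_add_bottom nim_add_bottom)

section \<open>Disjoint unions\<close>

lemma Field_next_to: "Field (next_to r s) = Inl_Vertex ` Field r \<union> Inr_Vertex ` Field s"
  by (force simp: Field_def next_to_def)

lemma poset_game_next_to:
  assumes "poset_game r" "poset_game s"
  shows "poset_game (next_to r s)"
proof -
  have "trans (next_to r s)"
    using assms by (auto simp: poset_game_iff next_to_def trans_def; blast)
  moreover have "antisym (next_to r s)"
    using assms by (auto simp: poset_game_iff next_to_def antisym_def)
  ultimately show ?thesis
    using assms unfolding poset_game_iff Field_next_to by (auto simp: next_to_def)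
qed

lemma next_to_mem:
  "(Inl_Vertex v, Inl_Vertex w) \<in> next_to r s \<longleftrightarrow> (v, w) \<in> r"
  "(Inr_Vertex v, Inr_Vertex w) \<in> next_to r s \<longleftrightarrow> (v, w) \<in> s"
  "(Inl_Vertex v, Inr_Vertex w) \<notin> next_to r s"
  "(Inr_Vertex v, Inl_Vertex w) \<notin> next_to r s"
  by (auto simp: next_to_def)

lemma move_next_to_Inl: "move (next_to r s) (Inl_Vertex v) = next_to (move r v) s"
  unfolding move_def[of "next_to r s"] Field_next_to
  using next_to_mem[where r = r and s = s]
  by (auto simp: next_to_def move_def intro: FieldI1 FieldI2)

lemma move_next_to_Inr: "move (next_to r s) (Inr_Vertex v) = next_to r (move s v)"
  unfolding move_def[of "next_to r s"] Field_next_to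
  using next_to_mem[where r = r and s = s]
  by (auto simp: next_to_def move_def intro: FieldI1 FieldI2)

text \<open>The zero case of the Sprague-Grundy theorem, which avoids computing with exclusive or.
  From equal values every move creates a difference; from different values the larger one can be
  lowered to the smaller.\<close>

lemma nim_next_to_eq_0_iff:
  assumes "poset_game r" "poset_game s"
  shows "nim (next_to r s) = 0 \<longleftrightarrow> nim r = nim s"
proof -
  \<comment> \<open>A move changes only one component, so an induction on \<open>s\<close> is nested
    in one on \<open>r\<close>; \<open>s\<close> stays quantified for the outer hypothesis.\<close>
  have "\<forall>s. poset_game r \<longrightarrow> poset_game s \<longrightarrow> (nim (next_to r s) = 0 \<longleftrightarrow> nim r = nim s)"
  proof (induction r rule: nim.induct)
    case (1 r)
    note IH_r = 1
    show ?case
    proof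
      fix s
      show "poset_game r \<longrightarrow> poset_game s \<longrightarrow> (nim (next_to r s) = 0 \<longleftrightarrow> nim r = nim s)"
      proof (induction s rule: nim.induct)
        case (1 s)
        note IH_s = 1
        show ?case
        proof (intro impI)
          assume r: "poset_game r" and s: "poset_game s"
          have "nim (next_to r s) = 0 \<longleftrightarrow>
              (\<forall>v\<in>Field r. nim (next_to (move r v) s) \<noteq> 0) \<and>
              (\<forall>v\<in>Field s. nim (next_to r (move s v)) \<noteq> 0)"
            unfolding nim_eq_0_iff[OF poset_game_next_to[OF r s]] Field_next_to
            by (simp add: ball_Un move_next_to_Inl move_next_to_Inr)
          also have "\<dots> \<longleftrightarrow>
              (\<forall>v\<in>Field r. nim (move r v) \<noteq> nim s) \<and> (\<forall>v\<in>Field s. nim r \<noteq> nim (move s v))"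
            using IH_r IH_s r s by (simp add: poset_game_move)
          \<comment> \<open>If the values differ, \<open>nim_optionE\<close> in the component of
            larger value reaches the smaller value; if they agree, \<open>nim_move_neq\<close>
            excludes every option.\<close>
          also have "\<dots> \<longleftrightarrow> nim r = nim s"
            using nim_move_neq[OF r] nim_move_neq[OF s] nim_optionE[OF r] nim_optionE[OF s]
            by (metis nat_neq_iff)
          finally show "nim (next_to r s) = 0 \<longleftrightarrow> nim r = nim s" .
        qed
      qed
    qed
  qed
  with assms show ?thesis by simp
qed

section \<open>The negation procedure\<close>

lemma extend_nim_0:
  assumes "poset_game r" "nim r = 0"
  shows "poset_game (extend i r)" "nim (extend i r) = 0"
  using assms
  by (simp_all add: extend_def poset_game_next_to add_bottom_funpow poset_game_tower
      nim_next_to_eq_0_iff nim_tower)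

theorem theorem2:
  fixes G :: "'a rel"
  assumes "poset_game G"
    and "nim G = 0"
  shows "nim (neg_game G) \<noteq> 0"
proof -
  define W where "W = while (\<lambda>(i, H). 2 ^ i \<le> card (Field G))
      (\<lambda>(i, H). (i + 1, extend i H)) (0, embed G)"
  obtain i G' where W: "W = (i, G')"
    by fastforce
  \<comment> \<open>The loop invariant leaves the counter free, since \<open>extend_nim_0\<close>
    holds for every \<open>i\<close>.\<close>
  have "case W of (i, H) \<Rightarrow> poset_game H \<and> nim H = 0"
    unfolding W_def
  proof (rule while_rule[where r = "measure (\<lambda>(i, H). card (Field G) - i)"])
    show "case (0, embed G) of (i, H) \<Rightarrow> poset_game H \<and> nim H = 0"
      using assms by (simp add: poset_game_embed nim_embed)
    fix p :: "nat \<times> 'a vertex rel"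
    assume "case p of (i, H) \<Rightarrow> 2 ^ i \<le> card (Field G)"
    \<comment> \<open>From \<open>i < 2 ^ i\<close> the guard bounds the counter strictly, so the
      truncated difference in the measure really decreases.\<close>
    then have "fst p < card (Field G)"
      by (auto intro: less_le_trans[OF less_exp])
    then show "((case p of (i, H) \<Rightarrow> (i + 1, extend i H)), p) \<in>
        measure (\<lambda>(i, H). card (Field G) - i)"
      by (auto split: prod.splits)
  qed (auto simp: extend_nim_0)
  then have G': "poset_game G'" "nim G' = 0"
    by (simp_all add: W)
  have "neg_game G = next_to (next_to G' (extend i G')) (tower (2 ^ (i + 1)))"
    using W unfolding neg_game_def W_def by simp
  moreover have nim_0: "nim (next_to G' (extend i G')) = 0"
    using G' by (simp add: extend_nim_0 nim_next_to_eq_0_iff)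
  \<comment> \<open>The last tower has the positive value \<open>2 ^ (i + 1)\<close>, which differs
    from the value 0 of the rest.\<close>
  ultimately show ?thesis
    using G' by (simp add: poset_game_next_to poset_game_tower extend_nim_0
        nim_next_to_eq_0_iff nim_tower nim_0)
qed

end
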